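(* Let $\rho \in [0,1)$ be fixed. For each integer $M \ge 1$ let $\Sigma_e \in \mathbb{R}^{M\times M}$ be the matrix with entries $\rho^{|i-j|}$. Let $C_{\Sigma_e}$ be the $M\times M$ circulant matrix with first row $(c_0,\dots,c_{M-1})$, $c_m = \rho^m + \frac{m}{M}(\rho^{M-m}-\rho^m)$ for $0 \le m \le M-1$, and let $C_{GS}$ be the $M\times M$ circulant matrix with first row $(c'_0,\dots,c'_{M-1})$, where $c'_0 = 1$ and $$c'_m = \frac{1}{1-\rho^M}\left(\rho^m + \rho^{M-m}\right) \quad \text{for } 1 \le m \le M-1.$$ Put $R_{\Sigma_e} = \Sigma_e - C_{\Sigma_e}$ and $R_{GS} = \Sigma_e - C_{GS}$. Then, as $M \to \infty$, $$\frac{1}{\sqrt{M}}\|R_{GS}\|_F = \frac{\sqrt{2}\,\rho}{(1-\rho^2)(1-\rho^M)}\,\frac{1}{\sqrt{M}} + O\!\left(\frac{1}{M}\right)$$ and $$\frac{1}{\sqrt{M}}\|R_{\Sigma_e}\|_F = \frac{\sqrt{2}\,\rho}{1-\rho^2}\,\frac{1}{\sqrt{M}} + O\!\left(\frac{1}{M}\right).$$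
   Context: A matrix $C$ is circulant with first row $(c_0, c_1, \dots, c_{M-1})$ if $C_{ij} = c_{(j-i) \bmod M}$. The Frobenius norm of a real matrix $A$ is $\|A\|_F = \sqrt{\operatorname{trace}(A^{\mathsf{T}}A)}$. The implied constants in $O(1/M)$ may depend on $\rho$ but not on $M$. The convention $0^0=1$ is used. *)

theory Defs
  imports Complex_Main "HOL-Library.Landau_Symbols" "Jordan_Normal_Form.Matrix"
begin

definition mat_trace :: "'a :: comm_monoid_add mat \<Rightarrow> 'a" where
  "mat_trace A = (\<Sum>i<dim_row A. A $$ (i, i))"

definition frobenius_norm :: "real mat \<Rightarrow> real" where
  "frobenius_norm A = sqrt (mat_trace (transpose_mat A * A))"

(* The difference of the column and row index is taken over the integers, so that it does
   not truncate; only the values c 0, ..., c (M - 1) of the first row are used. *)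
definition circulant_mat :: "nat \<Rightarrow> (nat \<Rightarrow> 'a) \<Rightarrow> 'a mat" where
  "circulant_mat M c = mat M M (\<lambda>(i, j). c (nat ((int j - int i) mod int M)))"

definition Sigma_e :: "real \<Rightarrow> nat \<Rightarrow> real mat" where
  "Sigma_e \<rho> M = mat M M (\<lambda>(i, j). \<rho> ^ nat \<bar>int i - int j\<bar>)"

definition C_Sigma_e :: "real \<Rightarrow> nat \<Rightarrow> real mat" where
  "C_Sigma_e \<rho> M =
     circulant_mat M (\<lambda>m. \<rho> ^ m + real m / real M * (\<rho> ^ (M - m) - \<rho> ^ m))"

definition C_GS :: "real \<Rightarrow> nat \<Rightarrow> real mat" where
  "C_GS \<rho> M =
     circulant_mat M (\<lambda>m. if m = 0 then 1 else 1 / (1 - \<rho> ^ M) * (\<rho> ^ m + \<rho> ^ (M - m)))"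

definition R_Sigma_e :: "real \<Rightarrow> nat \<Rightarrow> real mat" where
  "R_Sigma_e \<rho> M = Sigma_e \<rho> M - C_Sigma_e \<rho> M"

definition R_GS :: "real \<Rightarrow> nat \<Rightarrow> real mat" where
  "R_GS \<rho> M = Sigma_e \<rho> M - C_GS \<rho> M"

end

theory Submission
  imports Defs "HOL-Real_Asymp.Real_Asymp"
begin

text \<open>
  Both first rows are invariant under \<open>m \<mapsto> M - m\<close>, so the residuals are symmetric Toeplitz
  matrices whose entries at distance \<open>k\<close> from the diagonal are, up to sign,
  \<open>(\<rho> ^ (M - k) + \<rho> ^ (M + k)) / (1 - \<rho> ^ M)\<close> and \<open>k / M * (\<rho> ^ (M - k) - \<rho> ^ k)\<close>.
  They are of noticeable size only near the two corners far from the diagonal, so the substitution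
  \<open>n = M - k\<close> is natural: a distance \<open>k\<close> occurs \<open>2 (M - k) = 2 n\<close> times, and the
  leading part of the \<open>n\<close>-th entry is \<open>\<rho> ^ n\<close>
  (\<open>frobenius_norm_R_GS\<close>, \<open>frobenius_norm_R_Sigma_e\<close>). Apart from the factor
  \<open>1 / (1 - \<rho> ^ M)\<close> of the first norm, both squared norms are therefore close to
  \<open>2 * (\<Sum>n. n * \<rho> ^ (2 * n)) = a\<^sup>2\<close> with \<open>a = sqrt 2 * \<rho> / (1 - \<rho>\<^sup>2)\<close>.

  The distance to \<open>a\<^sup>2\<close> is \<open>O(1 / M)\<close>: the tail of the series and the corrections with the factor
  \<open>n / M\<close> are controlled by the convergent series of \<open>n\<^sup>2 * \<rho> ^ (2 * n)\<close>, and the remaining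
  terms by \<open>M\<^sup>2 * \<rho> ^ M\<close> (\<open>GS_sum_error\<close>, \<open>Sigma_e_sum_error\<close>,
  \<open>arithmetic_geometric_partial_sum\<close>). Hence each norm, with the factor
  \<open>1 / (1 - \<rho> ^ M)\<close> removed, differs from \<open>a\<close> by \<open>O(1 / sqrt M)\<close>, and the scaling by
  \<open>1 / sqrt M\<close> turns this into \<open>O(1 / M)\<close> (\<open>scaled_sqrt_bigo\<close>).
\<close>

section \<open>Frobenius norms of symmetric Toeplitz residuals\<close>

lemma frobenius_norm_mat:
  "frobenius_norm (mat M M f) = sqrt (\<Sum>j<M. \<Sum>i<M. (f (i, j))\<^sup>2)"
proof -
  have "mat_trace (transpose_mat (mat M M f) * mat M M f) = (\<Sum>j<M. \<Sum>i<M. (f (i, j))\<^sup>2)"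
    unfolding mat_trace_def
    by (simp add: scalar_prod_def power2_eq_square atLeast0LessThan)
  then show ?thesis
    by (simp add: frobenius_norm_def)
qed

text \<open>
  A distance \<open>k > 0\<close> occurs at \<open>2 * (M - k)\<close> positions. The sum is indexed by \<open>n = M - k\<close>, the
  distance to the far corners, where the residuals concentrate.
\<close>
lemma sum_abs_diff_index:
  fixes g :: "nat \<Rightarrow> real"
  assumes "g 0 = 0"
  shows "(\<Sum>j<M. \<Sum>i<M. g (nat \<bar>int i - int j\<bar>)) = 2 * (\<Sum>n<M. real n * g (M - n))"
proof -
  have "(\<Sum>j<N. \<Sum>i<N. g (nat \<bar>int i - int j\<bar>)) = 2 * (\<Sum>k\<le>N. real (N - k) * g k)" for N
  proof (induction N)
    case 0
    then show ?case by simp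
  next
    case (Suc N)
    \<comment> \<open>The new row and the new column both run through the distances \<open>1, \<dots>, N\<close>.\<close>
    have edge: "(\<Sum>i<N. g (N - i)) = (\<Sum>k\<le>N. g k)"
    proof -
      have "(\<Sum>i<N. g (N - i)) = (\<Sum>i\<le>N. g (N - i))"
        using assms by (simp add: lessThan_Suc_atMost [symmetric])
      also have "\<dots> = (\<Sum>k\<le>N. g k)"
        by (rule sum.reindex_bij_witness [of _ "\<lambda>k. N - k" "\<lambda>k. N - k"]) auto
      finally show ?thesis .
    qed
    have row: "(\<Sum>i<N. g (nat \<bar>int N - int i\<bar>)) = (\<Sum>k\<le>N. g k)"
      unfolding edge [symmetric] by (intro sum.cong refl arg_cong [of _ _ g]) auto
    have col: "(\<Sum>i<N. g (nat \<bar>int i - int N\<bar>)) = (\<Sum>k\<le>N. g k)"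
      unfolding edge [symmetric] by (intro sum.cong refl arg_cong [of _ _ g]) auto
    have "(\<Sum>k\<le>Suc N. real (Suc N - k) * g k) = (\<Sum>k\<le>N. real (N - k) * g k + g k)"
      by (simp, intro sum.cong refl) (auto simp: Suc_diff_le algebra_simps)
    then show ?case
      using Suc.IH row col assms by (simp add: sum.distrib)
  qed
  also have "(\<Sum>k\<le>M. real (M - k) * g k) = (\<Sum>n\<le>M. real n * g (M - n))"
    by (rule sum.reindex_bij_witness [of _ "\<lambda>n. M - n" "\<lambda>n. M - n"]) auto
  also have "\<dots> = (\<Sum>n<M. real n * g (M - n))"
    using assms by (simp add: lessThan_Suc_atMost [symmetric])
  finally show ?thesis .
qed

text \<open>
  Below the diagonal the index difference wraps around to \<open>M - (i - j)\<close>; the symmetry of the first row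
  undoes this, so the circulant matrix is also a symmetric Toeplitz matrix.
\<close>
lemma circulant_mat_index_symmetric:
  assumes "\<And>m. 0 < m \<Longrightarrow> m < M \<Longrightarrow> c (M - m) = c m" and "i < M" "j < M"
  shows "circulant_mat M c $$ (i, j) = c (nat \<bar>int i - int j\<bar>)"
proof (cases "i \<le> j")
  case True
  then have "(int j - int i) mod int M = int j - int i"
    using assms(3) by (intro mod_pos_pos_trivial) auto
  with True show ?thesis
    using assms(2,3) by (simp add: circulant_mat_def)
next
  case False
  then have "(int j - int i) mod int M = (int j - int i + int M) mod int M"
    by simp
  also have "\<dots> = int j - int i + int M"
    using False assms(2) by (intro mod_pos_pos_trivial) auto
  finally have "nat ((int j - int i) mod int M) = M - (i - j)"
    using False assms(2) by (simp add: nat_eq_iff)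
  moreover have "nat \<bar>int i - int j\<bar> = i - j"
    using False by simp
  ultimately show ?thesis
    using assms(1) [of "i - j"] assms(2,3) False by (simp add: circulant_mat_def)
qed

text \<open>
  The value \<open>c M\<close> lies outside the first row; it enters the sum only with weight \<open>n = 0\<close>.
\<close>
lemma frobenius_norm_toeplitz_minus_circulant:
  fixes t c :: "nat \<Rightarrow> real"
  assumes "\<And>m. 0 < m \<Longrightarrow> m < M \<Longrightarrow> c (M - m) = c m" and "t 0 = c 0"
  shows "frobenius_norm (mat M M (\<lambda>(i, j). t (nat \<bar>int i - int j\<bar>)) - circulant_mat M c)
    = sqrt (2 * (\<Sum>n<M. real n * (t (M - n) - c (M - n))\<^sup>2))"
proof -
  let ?g = "\<lambda>m. (t m - c m)\<^sup>2"
  have "mat M M (\<lambda>(i, j). t (nat \<bar>int i - int j\<bar>)) - circulant_mat M c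
      = mat M M (\<lambda>(i, j). t (nat \<bar>int i - int j\<bar>) - c (nat \<bar>int i - int j\<bar>))"
  proof (rule eq_matI)
    show "dim_row (mat M M (\<lambda>(i, j). t (nat \<bar>int i - int j\<bar>)) - circulant_mat M c)
      = dim_row (mat M M (\<lambda>(i, j). t (nat \<bar>int i - int j\<bar>) - c (nat \<bar>int i - int j\<bar>)))"
      "dim_col (mat M M (\<lambda>(i, j). t (nat \<bar>int i - int j\<bar>)) - circulant_mat M c)
      = dim_col (mat M M (\<lambda>(i, j). t (nat \<bar>int i - int j\<bar>) - c (nat \<bar>int i - int j\<bar>)))"
      by (simp_all add: circulant_mat_def)
  next
    fix i j
    assume "i < dim_row (mat M M (\<lambda>(i, j). t (nat \<bar>int i - int j\<bar>) - c (nat \<bar>int i - int j\<bar>)))"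
      "j < dim_col (mat M M (\<lambda>(i, j). t (nat \<bar>int i - int j\<bar>) - c (nat \<bar>int i - int j\<bar>)))"
    then have ij: "i < M" "j < M" by simp_all
    have dim: "dim_row (circulant_mat M c) = M" "dim_col (circulant_mat M c) = M"
      by (simp_all add: circulant_mat_def)
    show "(mat M M (\<lambda>(i, j). t (nat \<bar>int i - int j\<bar>)) - circulant_mat M c) $$ (i, j)
      = mat M M (\<lambda>(i, j). t (nat \<bar>int i - int j\<bar>) - c (nat \<bar>int i - int j\<bar>)) $$ (i, j)"
      using ij circulant_mat_index_symmetric [of M c, OF assms(1) ij] by (simp add: dim)
  qed
  then show ?thesis
    using sum_abs_diff_index [of ?g M] assms(2) by (simp add: frobenius_norm_mat)
qed

section \<open>The two residual norms\<close>

text \<open>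
  With \<open>k = M - n\<close>, the multiple \<open>\<rho> ^ k / (1 - \<rho> ^ M)\<close> in the first row exceeds \<open>\<rho> ^ k\<close> by
  \<open>\<rho> ^ (M + k) / (1 - \<rho> ^ M)\<close>, which explains the second summand \<open>\<rho> ^ (2 * M - n)\<close>.
\<close>
lemma frobenius_norm_R_GS:
  assumes "0 \<le> \<rho>" "\<rho> < 1" "0 < M"
  shows "frobenius_norm (R_GS \<rho> M)
    = sqrt (2 * (\<Sum>n<M. real n * (\<rho> ^ n + \<rho> ^ (2 * M - n))\<^sup>2)) / (1 - \<rho> ^ M)"
proof -
  let ?c = "\<lambda>m. if m = 0 then 1 else 1 / (1 - \<rho> ^ M) * (\<rho> ^ m + \<rho> ^ (M - m))"
  have pos: "0 < 1 - \<rho> ^ M"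
    using assms by (simp add: power_less_one_iff)
  have eq: "real n * (\<rho> ^ (M - n) - ?c (M - n))\<^sup>2
      = real n * (\<rho> ^ n + \<rho> ^ (2 * M - n))\<^sup>2 / (1 - \<rho> ^ M)\<^sup>2" if "n < M" for n
  proof -
    have "\<rho> ^ (2 * M - n) = \<rho> ^ (M - n) * \<rho> ^ M"
      using that by (simp add: power_add [symmetric] mult_2)
    then have "\<rho> ^ (M - n) - ?c (M - n) = - ((\<rho> ^ n + \<rho> ^ (2 * M - n)) / (1 - \<rho> ^ M))"
      using that pos by (simp add: field_simps)
    then show ?thesis
      by (simp only: power2_minus power_divide times_divide_eq_right)
  qed
  have "frobenius_norm (R_GS \<rho> M) = sqrt (2 * (\<Sum>n<M. real n * (\<rho> ^ (M - n) - ?c (M - n))\<^sup>2))"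
    unfolding R_GS_def Sigma_e_def C_GS_def
    by (rule frobenius_norm_toeplitz_minus_circulant) (auto simp: algebra_simps)
  also have "(\<Sum>n<M. real n * (\<rho> ^ (M - n) - ?c (M - n))\<^sup>2)
      = (\<Sum>n<M. real n * (\<rho> ^ n + \<rho> ^ (2 * M - n))\<^sup>2) / (1 - \<rho> ^ M)\<^sup>2"
    unfolding sum_divide_distrib using eq by (intro sum.cong) auto
  finally show ?thesis
    using pos by (simp add: real_sqrt_divide)
qed

lemma frobenius_norm_R_Sigma_e:
  assumes "0 < M"
  shows "frobenius_norm (R_Sigma_e \<rho> M)
    = sqrt (2 * (\<Sum>n<M. real n * ((1 - real n / real M) * (\<rho> ^ n - \<rho> ^ (M - n)))\<^sup>2))"
proof -
  let ?c = "\<lambda>m. \<rho> ^ m + real m / real M * (\<rho> ^ (M - m) - \<rho> ^ m)"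
  have "frobenius_norm (R_Sigma_e \<rho> M)
      = sqrt (2 * (\<Sum>n<M. real n * (\<rho> ^ (M - n) - ?c (M - n))\<^sup>2))"
    unfolding R_Sigma_e_def Sigma_e_def C_Sigma_e_def
    by (rule frobenius_norm_toeplitz_minus_circulant)
      (use assms in \<open>auto simp: field_simps of_nat_diff\<close>)
  also have "(\<Sum>n<M. real n * (\<rho> ^ (M - n) - ?c (M - n))\<^sup>2)
      = (\<Sum>n<M. real n * ((1 - real n / real M) * (\<rho> ^ n - \<rho> ^ (M - n)))\<^sup>2)"
  proof (intro sum.cong refl)
    fix n assume "n \<in> {..<M}"
    then have "\<rho> ^ (M - n) - ?c (M - n) = - ((1 - real n / real M) * (\<rho> ^ n - \<rho> ^ (M - n)))"
      by (simp add: of_nat_diff diff_divide_distrib)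
    then show "real n * (\<rho> ^ (M - n) - ?c (M - n))\<^sup>2
        = real n * ((1 - real n / real M) * (\<rho> ^ n - \<rho> ^ (M - n)))\<^sup>2"
      by (simp only: power2_minus)
  qed
  finally show ?thesis .
qed

section \<open>Weighted geometric sums\<close>

lemma arithmetic_geometric_sums:
  fixes x :: real
  assumes "\<bar>x\<bar> < 1"
  shows "(\<lambda>n. real n * x ^ n) sums (x / (1 - x)\<^sup>2)"
proof -
  have "(\<lambda>n. x * (real (Suc n) * x ^ n)) sums (x * (1 / (1 - x)\<^sup>2))"
    using geometric_deriv_sums [of x] assms by (intro sums_mult) simp
  then have "(\<lambda>n. real (Suc n) * x ^ Suc n) sums (x / (1 - x)\<^sup>2)"
    by (simp add: mult_ac)
  then show ?thesis
    by (subst (asm) sums_Suc_iff) simp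
qed

lemma summable_square_geometric:
  fixes x :: real
  assumes "0 \<le> x" "x < 1"
  shows "summable (\<lambda>n. (real n)\<^sup>2 * x ^ n)"
proof (cases "x = 0")
  case True
  then show ?thesis
    by (intro summable_finite [of "{0}"]) auto
next
  case False
  \<comment> \<open>Half of the exponential decay absorbs the polynomial factor.\<close>
  define y where "y = sqrt x"
  have y: "0 < y" "y < 1" "x = y * y"
    using assms False by (auto simp: y_def)
  then have "(\<lambda>n. (real n)\<^sup>2 * (y ^ n * y ^ n)) \<in> O(\<lambda>n. y ^ n)"
    by real_asymp
  then have "(\<lambda>n. (real n)\<^sup>2 * x ^ n) \<in> O(\<lambda>n. y ^ n)"
    by (simp add: y(3) power_mult_distrib)
  moreover have "summable (\<lambda>n. norm (y ^ n))"
    using y by (simp add: summable_geometric)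
  ultimately show ?thesis
    by (rule summable_comparison_test_bigo [rotated])
qed

lemma cube_geometric_bounded:
  fixes x :: real
  assumes "0 \<le> x" "x < 1"
  obtains B where "\<And>n. real n ^ 3 * x ^ n \<le> B"
proof -
  have "(\<lambda>n. real n ^ 3 * x ^ n) \<longlonglongrightarrow> 0"
  proof (cases "x = 0")
    case True
    have "eventually (\<lambda>n. real n ^ 3 * x ^ n = 0) sequentially"
      using eventually_gt_at_top [of 0] by eventually_elim (simp add: True)
    then show ?thesis
      by (rule tendsto_eventually)
  next
    case False
    with assms show ?thesis by real_asymp
  qed
  then have "Bseq (\<lambda>n. real n ^ 3 * x ^ n)"
    by (intro convergent_imp_Bseq convergentI)
  then obtain B where "\<And>n. norm (real n ^ 3 * x ^ n) \<le> B"
    unfolding Bseq_def by blast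
  then show ?thesis
    using that by (metis abs_le_D1 real_norm_def)
qed

text \<open>
  On the tail \<open>n \<ge> M\<close> the factor \<open>n\<close> is at most \<open>n\<^sup>2 / M\<close>. This crude bound already has the
  order that is needed, although the tail is exponentially small.
\<close>
lemma arithmetic_geometric_partial_sum:
  fixes x :: real
  assumes "0 \<le> x" "x < 1" "0 < M"
  shows "\<bar>(\<Sum>n<M. real n * x ^ n) - x / (1 - x)\<^sup>2\<bar> \<le> (\<Sum>n. (real n)\<^sup>2 * x ^ n) / real M"
proof -
  let ?a = "\<lambda>n. real n * x ^ n" and ?b = "\<lambda>n. (real n)\<^sup>2 * x ^ n"
  have a: "?a sums (x / (1 - x)\<^sup>2)"
    using assms by (intro arithmetic_geometric_sums) auto
  then have sa: "summable (\<lambda>n. ?a (n + M))"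
    using summable_ignore_initial_segment sums_summable by blast
  have sb: "summable ?b"
    using assms by (intro summable_square_geometric)
  then have sb': "summable (\<lambda>n. ?b (n + M))"
    using summable_ignore_initial_segment by blast
  have tail: "x / (1 - x)\<^sup>2 = (\<Sum>n. ?a (n + M)) + (\<Sum>n<M. ?a n)"
    using suminf_split_initial_segment [OF sums_summable [OF a]] sums_unique [OF a] by simp
  have "(\<Sum>n. ?a (n + M)) \<le> (\<Sum>n. ?b (n + M) / real M)"
  proof (rule suminf_le [OF _ sa summable_divide [OF sb']])
    fix n
    have "real (n + M) * real M \<le> (real (n + M))\<^sup>2"
      unfolding power2_eq_square by (intro mult_left_mono) auto
    then have "real (n + M) \<le> (real (n + M))\<^sup>2 / real M"
      using assms(3) by (simp add: pos_le_divide_eq)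
    then have "real (n + M) * x ^ (n + M) \<le> (real (n + M))\<^sup>2 / real M * x ^ (n + M)"
      using assms by (intro mult_right_mono) auto
    then show "?a (n + M) \<le> ?b (n + M) / real M"
      by simp
  qed
  also have "\<dots> = (\<Sum>n. ?b (n + M)) / real M"
    using sb' by (rule suminf_divide)
  also have "(\<Sum>n. ?b (n + M)) \<le> (\<Sum>n. ?b n)"
    using suminf_split_initial_segment [OF sb, of M] sum_nonneg [of "{..<M}" ?b] assms by simp
  finally have "(\<Sum>n. ?a (n + M)) \<le> (\<Sum>n. ?b n) / real M"
    using assms by (simp add: divide_right_mono)
  moreover have "0 \<le> (\<Sum>n. ?a (n + M))"
    using sa assms by (intro suminf_nonneg) auto
  ultimately show ?thesis
    using tail by simp
qed

section \<open>Comparison with the limit\<close>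

text \<open>
  Here \<open>\<bar>sqrt T - a\<bar>\<close> is at most the conjugate factor \<open>sqrt T + a\<close>, so its square is at most the
  product. Dividing \<open>T - a\<^sup>2\<close> by \<open>sqrt T + a\<close> would give a better bound for \<open>a > 0\<close>; the present form is
  uniform in \<open>a \<ge> 0\<close> and so covers \<open>\<rho> = 0\<close> as well.
\<close>
lemma abs_sqrt_diff_le:
  assumes "0 \<le> T" "0 \<le> a"
  shows "\<bar>sqrt T - a\<bar> \<le> sqrt \<bar>T - a\<^sup>2\<bar>"
proof (rule real_le_rsqrt)
  have "\<bar>sqrt T - a\<bar> * \<bar>sqrt T - a\<bar> \<le> \<bar>sqrt T - a\<bar> * \<bar>sqrt T + a\<bar>"
    using assms by (intro mult_left_mono) (auto simp: abs_le_iff)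
  also have "\<dots> = \<bar>(sqrt T - a) * (sqrt T + a)\<bar>"
    by (simp add: abs_mult)
  also have "(sqrt T - a) * (sqrt T + a) = T - a\<^sup>2"
    using assms by (simp add: algebra_simps power2_eq_square)
  finally show "\<bar>sqrt T - a\<bar>\<^sup>2 \<le> \<bar>T - a\<^sup>2\<bar>"
    by (simp add: power2_eq_square)
qed

text \<open>
  The passage from squared norms to norms, common to both residuals. The denominators \<open>d M\<close> stand
  for \<open>1 - \<rho> ^ M\<close> in one case and for \<open>1\<close> in the other.
\<close>
lemma scaled_sqrt_bigo:
  fixes T d :: "nat \<Rightarrow> real"
  assumes "0 \<le> a" "0 < \<delta>"
    and "\<And>M. 0 < M \<Longrightarrow> 0 \<le> T M"
    and "\<And>M. 0 < M \<Longrightarrow> \<bar>T M - a\<^sup>2\<bar> \<le> C / real M"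
    and "\<And>M. 0 < M \<Longrightarrow> \<delta> \<le> d M"
    and "\<And>M. 0 < M \<Longrightarrow> F M = sqrt (T M) / d M"
  shows "(\<lambda>M. 1 / sqrt (real M) * F M - a / d M * (1 / sqrt (real M))) \<in> O(\<lambda>M. 1 / real M)"
proof (rule bigoI [where c = "sqrt C / \<delta>"], rule eventually_mono [OF eventually_gt_at_top [of 0]])
  fix M :: nat assume M: "0 < M"
  have d: "0 < d M" "\<delta> \<le> d M"
    using assms(2) assms(5) [OF M] by auto
  have "\<bar>sqrt (T M) - a\<bar> \<le> sqrt \<bar>T M - a\<^sup>2\<bar>"
    using assms(1) assms(3) [OF M] by (rule abs_sqrt_diff_le [rotated])
  also have "\<dots> \<le> sqrt (C / real M)"
    using assms(4) [OF M] by simp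
  finally have le: "\<bar>sqrt (T M) - a\<bar> \<le> sqrt C / sqrt (real M)"
    by (simp add: real_sqrt_divide)
  have "1 / sqrt (real M) * F M - a / d M * (1 / sqrt (real M))
      = (sqrt (T M) - a) / d M / sqrt (real M)"
    using assms(6) [OF M] by (simp add: diff_divide_distrib)
  then have "norm (1 / sqrt (real M) * F M - a / d M * (1 / sqrt (real M)))
      = \<bar>sqrt (T M) - a\<bar> / d M / sqrt (real M)"
    using d by simp
  also have "\<dots> \<le> (sqrt C / sqrt (real M)) / \<delta> / sqrt (real M)"
    using le d assms(2) M by (intro divide_right_mono frac_le) auto
  also have "\<dots> = sqrt C / \<delta> * norm (1 / real M)"
    using M by simp
  finally show "norm (1 / sqrt (real M) * F M - a / d M * (1 / sqrt (real M)))
      \<le> sqrt C / \<delta> * norm (1 / real M)" .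
qed

text \<open>
  In the expanded square, \<open>n < M\<close> makes both the mixed and the last term at most a multiple of
  \<open>\<rho> ^ M\<close>.
\<close>
lemma GS_sum_error:
  fixes \<rho> :: real
  assumes "0 \<le> \<rho>" "\<rho> < 1" "0 < M"
  shows "\<bar>(\<Sum>n<M. real n * (\<rho> ^ n + \<rho> ^ (2 * M - n))\<^sup>2) - (\<Sum>n<M. real n * (\<rho>\<^sup>2) ^ n)\<bar>
    \<le> 3 * (real M)\<^sup>2 * \<rho> ^ M"
proof -
  have "\<bar>real n * (\<rho> ^ n + \<rho> ^ (2 * M - n))\<^sup>2 - real n * (\<rho>\<^sup>2) ^ n\<bar> \<le> real M * (3 * \<rho> ^ M)"
    if "n < M" for n
  proof -
    have prod: "\<rho> ^ n * \<rho> ^ (2 * M - n) = \<rho> ^ (2 * M)"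
      using that by (simp add: power_add [symmetric])
    have "(\<rho> ^ n + \<rho> ^ (2 * M - n))\<^sup>2 = (\<rho>\<^sup>2) ^ n + (2 * \<rho> ^ (2 * M) + (\<rho> ^ (2 * M - n))\<^sup>2)"
      unfolding power2_sum mult.assoc prod by (simp add: power_mult [symmetric] mult.commute)
    then have eq: "real n * (\<rho> ^ n + \<rho> ^ (2 * M - n))\<^sup>2 - real n * (\<rho>\<^sup>2) ^ n
        = real n * (2 * \<rho> ^ (2 * M) + (\<rho> ^ (2 * M - n))\<^sup>2)"
      by (simp add: algebra_simps)
    have "\<rho> ^ (2 * M) \<le> \<rho> ^ M" "(\<rho> ^ (2 * M - n))\<^sup>2 \<le> \<rho> ^ M"
      using assms that by (auto simp flip: power_mult intro!: power_decreasing)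
    then have "real n * (2 * \<rho> ^ (2 * M) + (\<rho> ^ (2 * M - n))\<^sup>2) \<le> real M * (3 * \<rho> ^ M)"
      using assms that by (intro mult_mono) auto
    then show ?thesis
      unfolding eq using assms by simp
  qed
  then have "(\<Sum>n<M. \<bar>real n * (\<rho> ^ n + \<rho> ^ (2 * M - n))\<^sup>2 - real n * (\<rho>\<^sup>2) ^ n\<bar>)
      \<le> (\<Sum>n<M. real M * (3 * \<rho> ^ M))"
    by (intro sum_mono) auto
  then show ?thesis
    unfolding sum_subtractf [symmetric]
    by (intro order_trans [OF sum_abs]) (simp add: power2_eq_square mult_ac)
qed

text \<open>
  With \<open>s = n / M\<close>, the factor \<open>(1 - s)\<^sup>2\<close> changes \<open>\<rho> ^ (2 * n)\<close> by at most the fraction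
  \<open>2 * s\<close>, which costs \<open>2 * n\<^sup>2 * \<rho> ^ (2 * n) / M\<close>. The same factor tames the term
  \<open>\<rho> ^ (2 * (M - n))\<close>, which is not small for \<open>n\<close> near \<open>M\<close>, that is, near the diagonal:
  there \<open>1 - s = (M - n) / M\<close>, and this term too is bounded through \<open>k\<^sup>2 * \<rho> ^ (2 * k) / M\<close>, now
  with \<open>k = M - n\<close>.
\<close>
lemma Sigma_e_sum_error:
  fixes \<rho> :: real
  assumes "0 \<le> \<rho>" "\<rho> < 1" "0 < M"
  shows "\<bar>(\<Sum>n<M. real n * ((1 - real n / real M) * (\<rho> ^ n - \<rho> ^ (M - n)))\<^sup>2)
      - (\<Sum>n<M. real n * (\<rho>\<^sup>2) ^ n)\<bar>
    \<le> 3 * (\<Sum>n. (real n)\<^sup>2 * (\<rho>\<^sup>2) ^ n) / real M + 2 * (real M)\<^sup>2 * \<rho> ^ M"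
proof -
  let ?b = "\<lambda>n. (real n)\<^sup>2 * (\<rho>\<^sup>2) ^ n"
  have x: "0 \<le> \<rho>\<^sup>2" "\<rho>\<^sup>2 < 1"
    using assms by (auto simp: power_less_one_iff)
  have sb: "summable ?b"
    using x by (rule summable_square_geometric)
  have "\<bar>real n * ((1 - real n / real M) * (\<rho> ^ n - \<rho> ^ (M - n)))\<^sup>2 - real n * (\<rho>\<^sup>2) ^ n\<bar>
      \<le> 2 * ?b n / real M + 2 * real M * \<rho> ^ M + ?b (M - n) / real M" if n: "n < M" for n
  proof -
    define s where "s = real n / real M"
    have s: "0 \<le> s" "s \<le> 1" "real n = s * real M"
      using n assms(3) by (auto simp: s_def)
    have Ms: "real (M - n) = (1 - s) * real M"
      using n s(3) by (simp add: of_nat_diff algebra_simps)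
    have p: "(\<rho> ^ n)\<^sup>2 = (\<rho>\<^sup>2) ^ n" "(\<rho> ^ (M - n))\<^sup>2 = (\<rho>\<^sup>2) ^ (M - n)"
      "\<rho> ^ n * \<rho> ^ (M - n) = \<rho> ^ M"
      using n by (simp_all add: power_add [symmetric] power_mult [symmetric] mult.commute)
    have sq: "(\<rho> ^ n - \<rho> ^ (M - n))\<^sup>2 = (\<rho>\<^sup>2) ^ n + (\<rho>\<^sup>2) ^ (M - n) - 2 * \<rho> ^ M"
      unfolding power2_diff mult.assoc p by simp
    \<comment> \<open>\<open>P\<close>: loss in the main term; \<open>Q\<close>: mixed term; \<open>R\<close>: the term large near the diagonal.\<close>
    define P where "P = real n * (2 * s - s\<^sup>2) * (\<rho>\<^sup>2) ^ n"
    define Q where "Q = real n * (1 - s)\<^sup>2 * (2 * \<rho> ^ M)"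
    define R where "R = real n * (1 - s)\<^sup>2 * (\<rho>\<^sup>2) ^ (M - n)"
    have split: "real n * ((1 - s) * (\<rho> ^ n - \<rho> ^ (M - n)))\<^sup>2 - real n * (\<rho>\<^sup>2) ^ n = R - Q - P"
      unfolding power_mult_distrib sq P_def Q_def R_def
      by (simp add: algebra_simps power2_eq_square)
    have s2: "0 \<le> 2 * s - s\<^sup>2" "0 \<le> (1 - s)\<^sup>2" "(1 - s)\<^sup>2 \<le> 1"
      using s mult_left_le [of s s] by (auto simp: power2_eq_square mult_le_one)
    have "P \<le> real n * (2 * s) * (\<rho>\<^sup>2) ^ n"
      unfolding P_def by (intro mult_right_mono mult_left_mono) auto
    also have "\<dots> = 2 * ?b n / real M"
      by (simp add: s_def power2_eq_square)
    finally have "P \<le> 2 * ?b n / real M" .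
    moreover have "Q \<le> real M * 1 * (2 * \<rho> ^ M)"
      unfolding Q_def using n s2 assms by (intro mult_mono) auto
    moreover have "R \<le> real M * (1 - s)\<^sup>2 * (\<rho>\<^sup>2) ^ (M - n)"
      unfolding R_def using n s2 by (intro mult_right_mono) auto
    moreover have "real M * (1 - s)\<^sup>2 * (\<rho>\<^sup>2) ^ (M - n) = ?b (M - n) / real M"
      unfolding Ms using assms(3) by (simp add: power2_eq_square)
    moreover have "0 \<le> P" "0 \<le> Q" "0 \<le> R"
      unfolding P_def Q_def R_def using s2 assms by auto
    ultimately show ?thesis
      unfolding s_def [symmetric] split by (simp add: abs_le_iff)
  qed
  then have "(\<Sum>n<M. \<bar>real n * ((1 - real n / real M) * (\<rho> ^ n - \<rho> ^ (M - n)))\<^sup>2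
        - real n * (\<rho>\<^sup>2) ^ n\<bar>)
      \<le> (\<Sum>n<M. 2 * ?b n / real M + 2 * real M * \<rho> ^ M + ?b (M - n) / real M)"
    by (intro sum_mono) auto
  also have "\<dots> = 2 * (\<Sum>n<M. ?b n) / real M + 2 * (real M)\<^sup>2 * \<rho> ^ M + (\<Sum>n<M. ?b (M - n)) / real M"
    by (simp add: sum.distrib sum_divide_distrib sum_distrib_left power2_eq_square)
  also have "(\<Sum>n<M. ?b (M - n)) = (\<Sum>n\<in>{1..M}. ?b n)"
    by (rule sum.reindex_bij_witness [of _ "\<lambda>k. M - k" "\<lambda>k. M - k"]) auto
  also have "2 * (\<Sum>n<M. ?b n) / real M + 2 * (real M)\<^sup>2 * \<rho> ^ M + (\<Sum>n\<in>{1..M}. ?b n) / real M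
      \<le> 2 * (\<Sum>n. ?b n) / real M + 2 * (real M)\<^sup>2 * \<rho> ^ M + (\<Sum>n. ?b n) / real M"
    using sb by (intro add_mono divide_right_mono mult_left_mono order_refl sum_le_suminf) auto
  finally show ?thesis
    unfolding sum_subtractf [symmetric]
    by (intro order_trans [OF sum_abs]) (simp add: add_divide_distrib)
qed

theorem mainTheorem6:
  fixes \<rho> :: real
  assumes "0 \<le> \<rho>" and "\<rho> < 1"
  shows "(\<lambda>M. 1 / sqrt (real M) * frobenius_norm (R_GS \<rho> M)
            - sqrt 2 * \<rho> / ((1 - \<rho>\<^sup>2) * (1 - \<rho> ^ M)) * (1 / sqrt (real M)))
           \<in> O[sequentially](\<lambda>M. 1 / real M)
       \<and> (\<lambda>M. 1 / sqrt (real M) * frobenius_norm (R_Sigma_e \<rho> M)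
            - sqrt 2 * \<rho> / (1 - \<rho>\<^sup>2) * (1 / sqrt (real M)))
           \<in> O[sequentially](\<lambda>M. 1 / real M)"
proof -
  define a where "a = sqrt 2 * \<rho> / (1 - \<rho>\<^sup>2)"
  define S where "S = (\<Sum>n. (real n)\<^sup>2 * (\<rho>\<^sup>2) ^ n)"
  define G where "G M = (\<Sum>n<M. real n * (\<rho> ^ n + \<rho> ^ (2 * M - n))\<^sup>2)" for M
  define E where
    "E M = (\<Sum>n<M. real n * ((1 - real n / real M) * (\<rho> ^ n - \<rho> ^ (M - n)))\<^sup>2)" for M
  have x: "0 \<le> \<rho>\<^sup>2" "\<rho>\<^sup>2 < 1"
    using assms by (auto simp: power_less_one_iff)
  have a: "0 \<le> a"
    using assms x by (simp add: a_def)
  have a2: "a\<^sup>2 = 2 * (\<rho>\<^sup>2 / (1 - \<rho>\<^sup>2)\<^sup>2)"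
    by (simp add: a_def power_divide power_mult_distrib)
  obtain B where B: "\<And>n. real n ^ 3 * \<rho> ^ n \<le> B"
    using cube_geometric_bounded [OF assms] by blast
  have small: "(real M)\<^sup>2 * \<rho> ^ M \<le> B / real M" if "0 < M" for M
    using B [of M] that by (simp add: pos_le_divide_eq power2_eq_square power3_eq_cube mult_ac)
  have limit: "\<bar>(\<Sum>n<M. real n * (\<rho>\<^sup>2) ^ n) - \<rho>\<^sup>2 / (1 - \<rho>\<^sup>2)\<^sup>2\<bar> \<le> S / real M" if "0 < M" for M
    unfolding S_def using x that by (rule arithmetic_geometric_partial_sum)
  have G: "\<bar>2 * G M - a\<^sup>2\<bar> \<le> (2 * S + 6 * B) / real M" if "0 < M" for M
    using GS_sum_error [OF assms that] limit [OF that] small [OF that]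
    unfolding a2 G_def [symmetric] add_divide_distrib by simp
  have E: "\<bar>2 * E M - a\<^sup>2\<bar> \<le> (8 * S + 4 * B) / real M" if "0 < M" for M
    using Sigma_e_sum_error [OF assms that] limit [OF that] small [OF that]
    unfolding a2 E_def [symmetric] S_def [symmetric] add_divide_distrib by simp
  have "(\<lambda>M. 1 / sqrt (real M) * frobenius_norm (R_GS \<rho> M)
      - a / (1 - \<rho> ^ M) * (1 / sqrt (real M))) \<in> O(\<lambda>M. 1 / real M)"
  proof (rule scaled_sqrt_bigo [where T = "\<lambda>M. 2 * G M" and \<delta> = "1 - \<rho>"])
    fix M :: nat assume "0 < M"
    then show "1 - \<rho> \<le> 1 - \<rho> ^ M"
      using assms power_decreasing [of 1 M \<rho>] by simp
  next
    fix M :: nat assume "0 < M"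
    then show "frobenius_norm (R_GS \<rho> M) = sqrt (2 * G M) / (1 - \<rho> ^ M)"
      unfolding G_def using assms by (intro frobenius_norm_R_GS)
  qed (use a assms G in \<open>auto simp: G_def intro!: sum_nonneg\<close>)
  moreover have "(\<lambda>M. 1 / sqrt (real M) * frobenius_norm (R_Sigma_e \<rho> M)
      - a / 1 * (1 / sqrt (real M))) \<in> O(\<lambda>M. 1 / real M)"
  proof (rule scaled_sqrt_bigo [where T = "\<lambda>M. 2 * E M" and \<delta> = 1])
    fix M :: nat assume "0 < M"
    then show "frobenius_norm (R_Sigma_e \<rho> M) = sqrt (2 * E M) / 1"
      unfolding E_def by (simp add: frobenius_norm_R_Sigma_e)
  qed (use a E in \<open>auto simp: E_def intro!: sum_nonneg\<close>)
  ultimately show ?thesis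
    by (simp add: a_def)
qed

end
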